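(* Let $f:\mathbb{R}^n\to[-\infty,+\infty]$ be a mapping and let $\widehat f:\mathbb{R}^n_\infty\to[-\infty,+\infty]$ be its continuation given by $\widehat f(x):=f(x)$ for $x\in\mathbb{R}^n$ and $\widehat f(\infty):=+\infty$. Then: (i) The following are equivalent: (a) $f$ is coercive; (b) $f:(\mathbb{R}^n,\mathcal{O}_n)\to([-\infty,+\infty],\mathcal{T})$ is topological coercive towards $\{+\infty\}$; (c) $\widehat f:(\mathbb{R}^n_\infty,(\mathcal{O}_n)_\infty)\to([-\infty,+\infty],\mathcal{T})$ is continuous at the point $\infty$; (d) $\widehat f:(\mathbb{R}^n_\infty,(\mathcal{O}_n)_\infty)\to([-\infty,+\infty],\mathcal{O}_\le)$ is continuous at the point $\infty$. (ii) $f$ is lower semicontinuous and coercive if and only if $\widehat f:(\mathbb{R}^n_\infty,(\mathcal{O}_n)_\infty)\to([-\infty,+\infty],\mathcal{T})$ is continuous.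
   Context: $\mathcal{O}_n$ is the natural topology of $\mathbb{R}^n$. The one-point compactification $(\mathbb{R}^n_\infty,(\mathcal{O}_n)_\infty)$ has underlying set $\mathbb{R}^n\cup\{\infty\}$ (with $\infty\notin\mathbb{R}^n$) and topology $\mathcal{O}_n\cup\{\mathbb{R}^n_\infty\setminus K: K\subseteq\mathbb{R}^n\text{ compact}\}$. $\mathcal{T}=\{\emptyset,[-\infty,+\infty]\}\cup\{(\alpha,+\infty]:\alpha\in[-\infty,+\infty)\}$ is the right order topology on $[-\infty,+\infty]$, and $\mathcal{O}_\le$ is the usual order topology on $[-\infty,+\infty]$. The function $f$ is coercive iff $f(x)\to+\infty$ as $\|x\|\to+\infty$. It is lower semicontinuous iff $f(x)\le\liminf_{l\to\infty}f(x_l)$ whenever $x_l\to x$ in $\mathbb{R}^n$. A mapping $f:(X,\mathcal{O})\to(X',\mathcal{O}')$ between topological spaces is topological coercive towards $S'\subseteq X'$ iff for every closed compact subset $K'$ of $X'$ with $K'\cap S'=\emptyset$ there is a closed compact subset $K$ of $X$ with $f[X\setminus K]\subseteq X'\setminus K'$. *)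

theory Defs
  imports "HOL-Analysis.Analysis"
begin

text \<open>The extended real line is the type \<^typ>\<open>ereal\<close>; its order topology is
  \<^term>\<open>euclidean :: ereal topology\<close>, as \<^typ>\<open>ereal\<close> is an instance of
  \<^class>\<open>order_topology\<close>. The one-point compactification is the library's
  \<^const>\<open>Alexandroff_compactification\<close>, where \<^const>\<open>None\<close> is the point at infinity;
  it asks for closed compact sets, and compact subsets of a Euclidean space are closed.\<close>

definition right_order_topology :: "ereal topology" where
  "right_order_topology =
     topology (\<lambda>U. U \<in> {{}, UNIV} \<union> {{\<alpha><..} |\<alpha>. \<alpha> < \<infinity>})"

lemma istopology_right_order:
  "istopology (\<lambda>U :: ereal set. U \<in> {{}, UNIV} \<union> {{\<alpha><..} |\<alpha>. \<alpha> < \<infinity>})"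
  (is "istopology (\<lambda>U. U \<in> ?T)")
  unfolding istopology_def
proof (intro conjI allI impI)
  fix S T :: "ereal set" assume S: "S \<in> ?T" and T: "T \<in> ?T"
  have int: "{a<..} \<inter> {b<..} \<in> ?T" if "a < \<infinity>" "b < \<infinity>" for a b :: ereal
  proof -
    have "{a<..} \<inter> {b<..} = {max a b<..}" by auto
    moreover have "max a b < \<infinity>" using that by (simp add: max_def)
    ultimately show ?thesis by (intro UnI2 CollectI exI[of _ "max a b"] conjI)
  qed
  show "S \<inter> T \<in> ?T"
  proof (cases "S \<in> {{}, UNIV} \<or> T \<in> {{}, UNIV}")
    case True
    then have "S \<inter> T \<in> {{}, S, T}" by auto
    then show ?thesis using S T by (elim insertE) simp_all
  next
    case False
    then have "S \<in> {{\<alpha><..} |\<alpha>. \<alpha> < \<infinity>}" "T \<in> {{\<alpha><..} |\<alpha>. \<alpha> < \<infinity>}"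
      using S T by (simp_all only: Un_iff de_Morgan_disj simp_thms)
    then obtain a b where "S = {a<..}" "a < \<infinity>" "T = {b<..}" "b < \<infinity>"
      by (elim CollectE exE conjE)
    then show ?thesis using int by simp
  qed
next
  fix \<K> :: "ereal set set" assume K: "\<forall>K\<in>\<K>. K \<in> ?T"
  show "\<Union>\<K> \<in> ?T"
  proof (cases "UNIV \<in> \<K> \<or> \<Union>\<K> = {}")
    case True
    then have "\<Union>\<K> = UNIV \<or> \<Union>\<K> = {}" by (metis Union_upper top.extremum_uniqueI)
    then show ?thesis by (elim disjE) simp_all
  next
    case False
    define A where "A = {\<alpha>. \<alpha> < \<infinity> \<and> {\<alpha><..} \<in> \<K>}"
    have "\<Union>\<K> \<subseteq> (\<Union>\<alpha>\<in>A. {\<alpha><..})"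
    proof
      fix x assume "x \<in> \<Union>\<K>"
      then obtain K' where K': "K' \<in> \<K>" "x \<in> K'" by (elim UnionE)
      have "K' \<noteq> {}" "K' \<noteq> UNIV" using K' False by (metis empty_iff, metis)
      moreover have "K' \<in> ?T" using K K'(1) by (rule bspec)
      ultimately have "K' \<in> {{\<alpha><..} |\<alpha>. \<alpha> < \<infinity>}"
        by (simp only: Un_iff insert_iff empty_iff simp_thms)
      then obtain \<alpha> where "\<alpha> < \<infinity>" "K' = {\<alpha><..}"
        by (elim CollectE exE conjE)
      with K' show "x \<in> (\<Union>\<alpha>\<in>A. {\<alpha><..})"
        by (intro UN_I[of \<alpha>]) (simp_all add: A_def)
    qed
    moreover have "(\<Union>\<alpha>\<in>A. {\<alpha><..}) \<subseteq> \<Union>\<K>"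
      by (intro UN_least Union_upper) (simp add: A_def)
    ultimately have U: "\<Union>\<K> = (\<Union>\<alpha>\<in>A. {\<alpha><..})" by (rule equalityI)
    have eq: "\<Union>\<K> = {Inf A<..}"
      unfolding U by (rule set_eqI) (simp add: Inf_less_iff)
    have "A \<noteq> {}" using U False by (metis UN_empty)
    then obtain a where a: "a \<in> A" by (metis all_not_in_conv)
    have "Inf A < \<infinity>"
    proof (rule le_less_trans)
      show "Inf A \<le> a" using a by (rule Inf_lower)
      show "a < \<infinity>" using a unfolding A_def by simp
    qed
    with eq show ?thesis by (intro UnI2 CollectI exI[of _ "Inf A"] conjI)
  qed
qed

lemma openin_right_order_topology:
  "openin right_order_topology U \<longleftrightarrow> U = {} \<or> U = UNIV \<or> (\<exists>\<alpha><\<infinity>. U = {\<alpha><..})"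
  unfolding right_order_topology_def topology_inverse'[OF istopology_right_order] by auto

definition coercive :: "('a::real_normed_vector \<Rightarrow> ereal) \<Rightarrow> bool" where
  "coercive f \<longleftrightarrow> (f \<longlongrightarrow> \<infinity>) at_infinity"

definition lower_semicontinuous :: "('a::topological_space \<Rightarrow> ereal) \<Rightarrow> bool" where
  "lower_semicontinuous f \<longleftrightarrow>
     (\<forall>x X. X \<longlonglongrightarrow> x \<longrightarrow> f x \<le> liminf (\<lambda>l. f (X l)))"

definition topological_coercive ::
    "'a topology \<Rightarrow> 'b topology \<Rightarrow> ('a \<Rightarrow> 'b) \<Rightarrow> 'b set \<Rightarrow> bool" where
  "topological_coercive X Y f S \<longleftrightarrow>
     f \<in> topspace X \<rightarrow> topspace Y \<and> S \<subseteq> topspace Y \<and>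
     (\<forall>K'. closedin Y K' \<and> compactin Y K' \<and> K' \<inter> S = {} \<longrightarrow>
       (\<exists>K. closedin X K \<and> compactin X K \<and> f ` (topspace X - K) \<subseteq> topspace Y - K'))"

fun extend_infinity :: "('a \<Rightarrow> ereal) \<Rightarrow> 'a option \<Rightarrow> ereal" where
  "extend_infinity f (Some x) = f x"
| "extend_infinity f None = \<infinity>"

end

theory Submission
  imports Defs
begin

text \<open>The closed compact sets of the right order topology that miss \<open>\<infinity>\<close> are \<open>{}\<close> and the
  rays \<open>{..\<alpha>}\<close> with \<open>\<alpha> < \<infinity>\<close>: a ray is compact because only the whole line is a neighbourhood
  of \<open>-\<infinity>\<close>. The neighbourhoods of \<open>\<infinity>\<close> in the compactification trace on the space the
  complements of compact sets, which generate the filter \<^const>\<open>at_infinity\<close>. So all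
  of (a)--(d) say that \<open>\<alpha> < f x\<close> eventually at infinity, for every \<open>\<alpha> < \<infinity>\<close>. At finite points,
  continuity into the right order topology is lower semicontinuity, as the domain is first
  countable.\<close>

text \<open>Closed balls are compact by Heine-Borel, and conversely a compact set is bounded, so it
  lies inside some ball.\<close>

lemma eventually_at_infinity_iff_compact:
  fixes P :: "'a::{real_normed_vector, heine_borel} \<Rightarrow> bool"
  shows "eventually P at_infinity \<longleftrightarrow> (\<exists>K. compact K \<and> (\<forall>x. x \<notin> K \<longrightarrow> P x))"
proof
  assume "eventually P at_infinity"
  then obtain b where "\<And>x. b \<le> norm x \<Longrightarrow> P x"
    by (auto simp: eventually_at_infinity)
  then show "\<exists>K. compact K \<and> (\<forall>x. x \<notin> K \<longrightarrow> P x)"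
    by (intro exI[of _ "cball 0 b"]) auto
next
  assume "\<exists>K. compact K \<and> (\<forall>x. x \<notin> K \<longrightarrow> P x)"
  then obtain K where K: "compact K" "\<And>x. x \<notin> K \<Longrightarrow> P x" by blast
  obtain b where "\<And>x. x \<in> K \<Longrightarrow> norm x < b"
    using compact_imp_bounded[OF K(1)] by (metis bounded_pos_less)
  then show "eventually P at_infinity"
    using K(2) by (meson eventually_at_infinity not_le)
qed

text \<open>The assumption on \<open>range g\<close> is there because
  \<open>topcontinuous_at\<close> demands that \<open>g\<close> map into \<open>topspace Y\<close>,
  while \<open>limitin\<close> constrains only the eventual values.\<close>

lemma topcontinuous_at_Alexandroff_None:
  fixes g :: "'a::{real_normed_vector, heine_borel} option \<Rightarrow> 'b"
  assumes "range g \<subseteq> topspace Y"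
  shows "topcontinuous_at (Alexandroff_compactification euclidean) Y g None \<longleftrightarrow>
         limitin Y (g \<circ> Some) (g None) at_infinity"
proof -
  have "(\<exists>U. openin (Alexandroff_compactification euclidean) U \<and> None \<in> U \<and> (\<forall>y\<in>U. g y \<in> V))
      \<longleftrightarrow> eventually (\<lambda>x. g (Some x) \<in> V) at_infinity" (is "?lhs \<longleftrightarrow> ?rhs") if "g None \<in> V" for V
  proof
    assume ?lhs
    then show ?rhs
      unfolding openin_Alexandroff_compactification eventually_at_infinity_iff_compact by force
  next
    assume ?rhs
    then obtain K where "compact K" "\<And>x. x \<notin> K \<Longrightarrow> g (Some x) \<in> V"
      unfolding eventually_at_infinity_iff_compact by blast
    with that show ?lhs
      unfolding openin_Alexandroff_compactification
      \<comment> \<open>The witness is the complement of \<open>K\<close> in the compactification, a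
        basic neighbourhood of \<open>None\<close>.\<close>
      by (intro exI[of _ "insert None (Some ` (- K))"])
         (auto simp: compact_imp_closed Compl_eq_Diff_UNIV)
  qed
  with assms show ?thesis
    unfolding topcontinuous_at_def limitin_def by (auto simp: image_subset_iff)
qed

text \<open>\<open>Some\<close> is an open embedding, so continuity of \<open>g\<close> at
  \<open>Some x\<close> is continuity of \<open>g \<circ> Some\<close> at \<open>x\<close>; only the
  point \<open>None\<close> remains.\<close>

lemma continuous_map_Alexandroff_iff:
  "continuous_map (Alexandroff_compactification X) Y g \<longleftrightarrow>
   continuous_map X Y (g \<circ> Some) \<and> topcontinuous_at (Alexandroff_compactification X) Y g None"
  (is "?lhs \<longleftrightarrow> ?rhs")
proof
  assume ?lhs
  then show ?rhs
    using continuous_map_compose[OF continuous_map_Some]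
    by (auto simp: continuous_map_eq_topcontinuous_at)
next
  assume R: ?rhs
  have "topcontinuous_at (Alexandroff_compactification X) Y g (Some x)" if x: "x \<in> topspace X" for x
    unfolding topcontinuous_at_def
  proof (intro conjI allI impI)
    show "g \<in> topspace (Alexandroff_compactification X) \<rightarrow> topspace Y"
      using R by (simp add: topcontinuous_at_def)
    fix V assume V: "openin Y V \<and> g (Some x) \<in> V"
    have "topcontinuous_at X Y (g \<circ> Some) x"
      using R x by (simp add: continuous_map_eq_topcontinuous_at)
    with V obtain U where "openin X U" "x \<in> U" "\<forall>y\<in>U. g (Some y) \<in> V"
      by (auto simp: topcontinuous_at_def)
    then show "\<exists>U. openin (Alexandroff_compactification X) U \<and> Some x \<in> U \<and> (\<forall>y\<in>U. g y \<in> V)"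
      by (intro exI[of _ "Some ` U"]) auto
  qed (use x in auto)
  with R show ?lhs
    by (auto simp: continuous_map_eq_topcontinuous_at)
qed

lemma topspace_right_order_topology [simp]: "topspace right_order_topology = UNIV"
  using openin_subset[of right_order_topology UNIV] by (auto simp: openin_right_order_topology)

text \<open>Apart from the whole space, the open sets containing \<open>l\<close> are exactly the
  rays \<open>{\<alpha><..}\<close> with \<open>\<alpha> < l\<close>.\<close>

lemma limitin_right_order_topology:
  "limitin right_order_topology f l F \<longleftrightarrow> (\<forall>\<alpha><l. eventually (\<lambda>x. \<alpha> < f x) F)"
  (is "?lhs \<longleftrightarrow> ?rhs")
proof
  assume L: ?lhs
  show ?rhs
  proof (intro allI impI)
    fix \<alpha> assume "\<alpha> < l"
    moreover from this have "\<alpha> < \<infinity>"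
      by (rule less_le_trans) simp
    ultimately have "openin right_order_topology {\<alpha><..}" "l \<in> {\<alpha><..}"
      unfolding openin_right_order_topology by (blast, simp)
    with L have "eventually (\<lambda>x. f x \<in> {\<alpha><..}) F"
      unfolding limitin_def by blast
    then show "eventually (\<lambda>x. \<alpha> < f x) F" by simp
  qed
next
  assume R: ?rhs
  have "eventually (\<lambda>x. f x \<in> U) F" if "openin right_order_topology U" "l \<in> U" for U
    using that(1) unfolding openin_right_order_topology
  proof (elim disjE exE conjE)
    fix \<alpha> assume "U = {\<alpha><..}"
    with R that(2) show ?thesis by simp
  qed (use that(2) in simp_all)
  then show ?lhs by (simp add: limitin_def)
qed

lemma closedin_right_order_topology:
  "closedin right_order_topology K \<longleftrightarrow> K = {} \<or> K = UNIV \<or> (\<exists>\<alpha><\<infinity>. K = {..\<alpha>})"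
proof -
  have "- K = {\<alpha><..} \<longleftrightarrow> K = {..\<alpha>}" for \<alpha> :: ereal
    by (metis Compl_atMost double_complement)
  then show ?thesis
    by (auto simp: closedin_def openin_right_order_topology simp flip: Compl_eq_Diff_UNIV)
qed

lemma compactin_right_order_topology_atMost: "compactin right_order_topology {..\<alpha>}"
  unfolding compactin_def
proof (intro conjI allI impI)
  fix \<U> assume U: "(\<forall>U\<in>\<U>. openin right_order_topology U) \<and> {..\<alpha>} \<subseteq> \<Union>\<U>"
  \<comment> \<open>The point \<open>-\<infinity>\<close> lies in \<open>{..\<alpha>}\<close> for
    every \<open>\<alpha>\<close>, and the member of the cover containing it will be a subcover by
    itself.\<close>
  then have "-\<infinity> \<in> \<Union>\<U>"
    by (intro subsetD[of "{..\<alpha>}" "\<Union>\<U>"]) auto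
  then obtain U where "U \<in> \<U>" "-\<infinity> \<in> U" by blast
  moreover from this U have "U = UNIV"
    by (auto simp: openin_right_order_topology)
  ultimately show "\<exists>\<F>. finite \<F> \<and> \<F> \<subseteq> \<U> \<and> {..\<alpha>} \<subseteq> \<Union>\<F>"
    by (intro exI[of _ "{U}"]) auto
qed auto

text \<open>In the order topology, convergence to \<open>\<infinity>\<close> also involves bounds
  above the limit, but nothing exceeds \<open>\<infinity>\<close>; only the lower bounds
  remain.\<close>

lemma coercive_iff_limitin_right_order:
  "coercive f \<longleftrightarrow> limitin right_order_topology f \<infinity> at_infinity"
  by (auto simp: coercive_def order_tendsto_iff limitin_right_order_topology)

lemma coercive_iff_topological_coercive:
  fixes f :: "'a::{real_normed_vector, heine_borel} \<Rightarrow> ereal"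
  shows "coercive f \<longleftrightarrow> topological_coercive euclidean right_order_topology f {\<infinity>}"
proof -
  have "(\<exists>K. closed K \<and> compact K \<and> f ` (UNIV - K) \<subseteq> UNIV - K') \<longleftrightarrow>
        eventually (\<lambda>x. f x \<notin> K') at_infinity" for K'
    unfolding eventually_at_infinity_iff_compact
    by (intro ex_cong1) (auto simp: compact_imp_closed)
  then have "topological_coercive euclidean right_order_topology f {\<infinity>} \<longleftrightarrow>
        (\<forall>K'. closedin right_order_topology K' \<and> compactin right_order_topology K' \<and> \<infinity> \<notin> K' \<longrightarrow>
          eventually (\<lambda>x. f x \<notin> K') at_infinity)"
    by (simp add: topological_coercive_def)
  also have "\<dots> \<longleftrightarrow> (\<forall>\<alpha><\<infinity>. eventually (\<lambda>x. f x \<notin> {..\<alpha>}) at_infinity)"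
  proof -
    \<comment> \<open>The closed set \<open>UNIV\<close> is excluded since it contains
      \<open>\<infinity>\<close>; the other closed sets are all compact. The case
      \<open>K' = {}\<close> then imposes no condition on \<open>f\<close>.\<close>
    have "closedin right_order_topology K' \<and> compactin right_order_topology K' \<and> \<infinity> \<notin> K' \<longleftrightarrow>
          K' = {} \<or> (\<exists>\<alpha><\<infinity>. K' = {..\<alpha>})" for K'
      by (auto simp: closedin_right_order_topology compactin_right_order_topology_atMost)
    then show ?thesis
      by (simp only: imp_disjL all_conj_distrib imp_ex imp_conjL) simp
  qed
  finally show ?thesis
    by (simp add: coercive_iff_limitin_right_order limitin_right_order_topology not_le)
qed

lemma lower_semicontinuous_iff_continuous_map:
  fixes f :: "'a::first_countable_topology \<Rightarrow> ereal"
  shows "lower_semicontinuous f \<longleftrightarrow> continuous_map euclidean right_order_topology f"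
proof -
  \<comment> \<open>\<open>atin\<close> uses punctured neighbourhoods. Here \<open>P y\<close> will
    be \<open>\<alpha> < f y\<close> with \<open>\<alpha> < f x\<close>, so it holds at the centre
    and puncturing makes no difference.\<close>
  have "eventually P (atin euclidean x) \<longleftrightarrow> eventually P (nhds x)" if "P x" for P and x :: 'a
  proof -
    have "(\<forall>y\<in>U - {x}. P y) \<longleftrightarrow> (\<forall>y\<in>U. P y)" for U
      using that by auto
    then show ?thesis
      by (simp add: eventually_atin eventually_nhds)
  qed
  then have "continuous_map euclidean right_order_topology f \<longleftrightarrow>
        (\<forall>x. \<forall>\<alpha><f x. eventually (\<lambda>y. \<alpha> < f y) (nhds x))"
    by (simp add: continuous_map_atin limitin_right_order_topology)
  also have "\<dots> \<longleftrightarrow> lower_semicontinuous f"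
    \<comment> \<open>First countability lets sequences converging to \<open>x\<close> test the
      neighbourhood filter, and the liminf inequality unfolds to the same lower bounds
      \<open>\<alpha> < f x\<close>.\<close>
    unfolding lower_semicontinuous_def le_Liminf_iff eventually_nhds_iff_sequentially by blast
  finally show ?thesis by simp
qed

theorem theorem2p5p16:
  fixes f :: "real ^ 'n \<Rightarrow> ereal"
  defines "fhat \<equiv> extend_infinity f"
  defines "Rn_inf \<equiv> Alexandroff_compactification (euclidean :: (real ^ 'n) topology)"
  shows
    "((coercive f \<longleftrightarrow> topological_coercive euclidean right_order_topology f {\<infinity>}) \<and>
      (coercive f \<longleftrightarrow> topcontinuous_at Rn_inf right_order_topology fhat None) \<and>
      (coercive f \<longleftrightarrow> topcontinuous_at Rn_inf (euclidean :: ereal topology) fhat None)) \<and>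
     (lower_semicontinuous f \<and> coercive f \<longleftrightarrow>
        continuous_map Rn_inf right_order_topology fhat)"
proof -
  have fhat: "fhat \<circ> Some = f" "fhat None = \<infinity>"
    by (auto simp: fhat_def)
  \<comment> \<open>Continuity at \<open>None\<close> is convergence of \<open>f\<close> to
    \<open>\<infinity>\<close> along \<open>at_infinity\<close>, for either topology on the
    range.\<close>
  have c: "coercive f \<longleftrightarrow> topcontinuous_at Rn_inf right_order_topology fhat None"
    unfolding Rn_inf_def
    by (simp add: topcontinuous_at_Alexandroff_None fhat coercive_iff_limitin_right_order)
  have d: "coercive f \<longleftrightarrow> topcontinuous_at Rn_inf (euclidean :: ereal topology) fhat None"
    unfolding Rn_inf_def
    by (simp add: topcontinuous_at_Alexandroff_None fhat coercive_def)
  have "lower_semicontinuous f \<and> coercive f \<longleftrightarrow> continuous_map Rn_inf right_order_topology fhat"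
    using c unfolding Rn_inf_def
    by (simp add: continuous_map_Alexandroff_iff fhat lower_semicontinuous_iff_continuous_map)
  with c d coercive_iff_topological_coercive[of f] show ?thesis by blast
qed

end
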